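(* Let $k$ and $n$ be positive integers. If $$F_1+2F_2+\cdots+kF_k=F_n^2,$$ then $(k,n)\in\{(1,1),(1,2),(3,4)\}$; among these solutions only $(3,4)$ is non-trivial.
   Context: $(F_n)_{n\ge 0}$ is the Fibonacci sequence: $F_0=0$, $F_1=1$, $F_{n+2}=F_{n+1}+F_n$ for all $n\ge 0$. The left-hand side of the equation is $\sum_{j=1}^k jF_j$. For fixed positive integers $p,q$, the trivial solutions of $\sum_{j=1}^k jF_j^p=F_n^q$ in positive integers $k,n$ are those coming from $F_1^p=1=F_1^q=F_2^q$, i.e. $(k,n)=(1,1),(1,2)$, and from $F_1^p+2F_2^p=3=F_4$, i.e. $(k,n)=(2,4)$ when $q=1$; all other solutions are called non-trivial. *)

theory Defs
  imports "HOL-Number_Theory.Fib"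
begin

definition fib_solution :: "nat \<Rightarrow> nat \<Rightarrow> nat \<Rightarrow> nat \<Rightarrow> bool" where
  "fib_solution p q k n \<longleftrightarrow>
     0 < k \<and> 0 < n \<and> (\<Sum>j = 1..k. j * fib j ^ p) = fib n ^ q"

(* From 1 = F_1 = F_2, and from F_1^p + 2 F_2^p = 3 = F_4 when q = 1. *)
definition trivial_fib_solution :: "nat \<Rightarrow> nat \<Rightarrow> nat \<Rightarrow> nat \<Rightarrow> bool" where
  "trivial_fib_solution p q k n \<longleftrightarrow>
     fib_solution p q k n \<and> ((k, n) \<in> {(1, 1), (1, 2)} \<or> q = 1 \<and> (k, n) = (2, 4))"

definition nontrivial_fib_solution :: "nat \<Rightarrow> nat \<Rightarrow> nat \<Rightarrow> nat \<Rightarrow> bool" where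
  "nontrivial_fib_solution p q k n \<longleftrightarrow>
     fib_solution p q k n \<and> \<not> trivial_fib_solution p q k n"

end

theory Submission
  imports Defs
begin

text \<open>
  The idea is to read the equation modulo the large Fibonacci number \<open>F\<^bsub>k+2\<^esub>\<close>.  The sum telescopes to
  \<open>(k - 1) F\<^bsub>k+2\<^esub> - F\<^bsub>k+1\<^esub> + 2\<close>, and \<open>5 F\<^sub>n\<^sup>2\<close> is the Lucas number \<open>L\<^bsub>2n\<^esub>\<close> up to an error
  of \<open>\<plusminus>2\<close>.  Comparing sizes, the excess \<open>t = 2n - (k + 2)\<close> is nonnegative for \<open>k \<ge> 2\<close>, and since the sum
  is less than \<open>k F\<^bsub>k+2\<^esub>\<close>, the number \<open>L\<^sub>t\<close> is bounded by a linear function of \<open>k\<close>.  Expanding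
  \<open>L\<^bsub>k+2+t\<^esub> = F\<^bsub>k+2\<^esub> L\<^bsub>t+1\<^esub> + F\<^bsub>k+1\<^esub> L\<^sub>t\<close> and reducing leaves
  \<open>F\<^bsub>k+1\<^esub> (L\<^sub>t + 5) \<equiv> c (mod F\<^bsub>k+2\<^esub>)\<close> with \<open>c = 8\<close> or \<open>c = 12\<close>.

  By Cassini's identity \<open>F\<^bsub>k+1\<^esub>\<close> is its own inverse modulo \<open>F\<^bsub>k+2\<^esub>\<close> up to sign, so the small number
  \<open>L\<^sub>t + 5\<close> is congruent to \<open>\<plusminus> c F\<^bsub>k+1\<^esub>\<close>.  But \<open>8 F\<^bsub>k+1\<^esub>\<close> and \<open>12 F\<^bsub>k+1\<^esub>\<close> stay at distance at
  least \<open>F\<^bsub>k-4\<^esub>\<close> from every multiple of \<open>F\<^bsub>k+2\<^esub>\<close>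
  (lemma \<open>inverse_residue_not_small\<close>), and \<open>F\<^bsub>k-4\<^esub>\<close> grows exponentially.
  This excludes \<open>k \<ge> 17\<close>, and the remaining values of \<open>k\<close> are inspected one by one.
\<close>

section \<open>Lucas numbers\<close>

fun lucas :: "nat \<Rightarrow> nat" where
  "lucas 0 = 2"
| "lucas (Suc 0) = 1"
| "lucas (Suc (Suc n)) = lucas (Suc n) + lucas n"

lemma lucas_Suc: "lucas (Suc n) = fib (Suc n) + 2 * fib n"
  by (induction n rule: fib.induct) auto

text \<open>Modulo \<open>F\<^bsub>s+1\<^esub>\<close> only the second product survives, and there the index \<open>t\<close> is small.\<close>

lemma lucas_add: "lucas (Suc s + t) = fib (Suc s) * lucas (Suc t) + fib s * lucas t"
proof (induction t rule: fib.induct)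
  case (3 t)
  then show ?case
    by (simp add: algebra_simps)
qed (simp_all add: lucas_Suc)

text \<open>
  This makes the square accessible to \<open>lucas_add\<close>: up to a bounded error it is linear in Lucas numbers.
\<close>

lemma five_fib_square:
  "5 * (int (fib n))\<^sup>2 = int (lucas (2 * n)) - 2 * (-1) ^ n"
proof (cases n)
  case (Suc s)
  define f g where "f = int (fib (Suc s))" and "g = int (fib s)"
  have cassini: "(f + g) * g - f\<^sup>2 = - ((-1) ^ s)"
    using fib_Cassini_int[of s] by (simp add: f_def g_def)
  have "lucas (2 * n) = lucas (Suc s + Suc s)"
    by (simp only: Suc mult_2)
  also have "int \<dots> = f * (3 * f + g) + g * (f + 2 * g)"
    unfolding lucas_add by (simp add: lucas_Suc f_def g_def algebra_simps)
  finally have "int (lucas (2 * n)) = 5 * f\<^sup>2 - 2 * (f\<^sup>2 - (f + g) * g)"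
    by (simp add: algebra_simps power2_eq_square)
  moreover have "f\<^sup>2 - (f + g) * g = (-1) ^ s"
    using cassini by simp
  moreover have "int (fib n) = f"
    by (simp only: Suc f_def)
  moreover have "(-1 :: int) ^ n = - ((-1) ^ s)"
    by (simp add: Suc)
  ultimately show ?thesis
    by simp
qed simp

section \<open>The weighted sum and its size\<close>

lemma sum_mult_fib: "(\<Sum>j = 1..k. j * fib j) + fib (k + 3) = k * fib (k + 2) + 2"
  by (induction k) (auto simp: algebra_simps numeral_eq_Suc)

lemma fib_square_le: "0 < n \<Longrightarrow> (fib n)\<^sup>2 \<le> fib (2 * n - 1)"
  using fib_add[of "n - 1" "n - 1"]
  by (cases n) (simp_all add: power2_eq_square mult_2 del: fib.simps)

text \<open>The last summand alone exceeds \<open>F\<^sub>k\<close>, whereas \<open>F\<^sub>n\<^sup>2 \<le> F\<^bsub>2n-1\<^esub>\<close>.\<close>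

lemma index_lower_bound:
  assumes "2 \<le> k" and "0 < n" and eq: "(\<Sum>j = 1..k. j * fib j) = (fib n)\<^sup>2"
  shows "k + 2 \<le> 2 * n"
proof (rule ccontr)
  assume "\<not> k + 2 \<le> 2 * n"
  then have "(fib n)\<^sup>2 \<le> fib k"
    using fib_square_le[OF \<open>0 < n\<close>] fib_mono[of "2 * n - 1" k] by linarith
  moreover have "k * fib k \<le> (\<Sum>j = 1..k. j * fib j)"
    using \<open>2 \<le> k\<close> by (intro member_le_sum) auto
  moreover have "fib k < k * fib k"
    using \<open>2 \<le> k\<close> fib_neq_0_nat[of k] by simp
  ultimately show False
    using eq by linarith
qed

text \<open>
  Stepping the two accumulators of \<open>gen_fib\<close> evaluates Fibonacci numbers at numerals in linearly many
  rewrites, where the defining recursion would branch.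
\<close>

lemma gen_fib_numeral: "gen_fib a b (numeral v) = gen_fib b (a + b) (pred_numeral v)"
  by (cases "pred_numeral v") (simp_all add: numeral_eq_Suc)

lemma gen_fib_one: "gen_fib a b 1 = b"
  by simp

lemmas fib_eval = fib_conv_gen_fib gen_fib_numeral gen_fib_one

text \<open>
  With \<open>j = k - 4\<close> the left-hand side is \<open>10 (k - 1) + 5\<close>, the bound that \<open>L\<^sub>t + 5\<close> satisfies below;
  \<open>j = 13\<close> is the first index at which the Fibonacci number is larger.
\<close>

lemma linear_less_fib: "13 \<le> j \<Longrightarrow> 10 * j + 35 < fib j"
proof (induction j rule: dec_induct)
  case base
  show ?case by (simp add: fib_eval del: One_nat_def)
next
  case (step j)
  have "fib 12 \<le> fib (j - 1)"
    using step.hyps by (intro fib_mono) simp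
  moreover have "fib 12 = 144"
    by (simp add: fib_eval del: One_nat_def)
  moreover have "fib (Suc j) = fib j + fib (j - 1)"
    using step.hyps by (cases j) auto
  ultimately show ?case
    using step.IH by simp
qed

section \<open>The congruence\<close>

text \<open>
  For consecutive Fibonacci numbers \<open>x = F\<^sub>j\<close>, \<open>y = F\<^bsub>j+1\<^esub>\<close> the two linear forms are
  \<open>8y + 5x = F\<^bsub>j+6\<^esub>\<close> and \<open>5y + 3x = F\<^bsub>j+5\<^esub>\<close>.  Cassini's identity makes the square of the second
  congruent to \<open>s\<close> modulo the first, so the divisibility would force \<open>B \<equiv> s c (5y + 3x)\<close>.
  Now \<open>8 (5y + 3x) \<equiv> -x\<close> and \<open>12 (5y + 3x) \<equiv> 4y + x\<close>, and neither residue, with either sign, has a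
  representative strictly between \<open>0\<close> and \<open>x\<close>.
\<close>

lemma inverse_residue_not_small:
  fixes x y s B c :: int
  assumes cassini: "y\<^sup>2 - x * y - x\<^sup>2 = s" and s: "s = 1 \<or> s = -1"
    and B: "0 < B" "B < x" and "0 < y" and c: "c = 8 \<or> c = 12"
  shows "\<not> (8 * y + 5 * x) dvd ((5 * y + 3 * x) * B - c)"
proof
  define M N where "M = 8 * y + 5 * x" and "N = 5 * y + 3 * x"
  have square: "N\<^sup>2 = M * (3 * y + 2 * x) + s"
    unfolding M_def N_def cassini[symmetric] by (simp add: algebra_simps power2_eq_square)
  assume "(8 * y + 5 * x) dvd ((5 * y + 3 * x) * B - c)"
  then have "M dvd N * (N * B - c) - M * ((3 * y + 2 * x) * B)"
    by (simp add: M_def N_def)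
  also have "N * (N * B - c) - M * ((3 * y + 2 * x) * B) = N\<^sup>2 * B - M * (3 * y + 2 * x) * B - c * N"
    by (simp add: algebra_simps power2_eq_square)
  also have "\<dots> = s * B - c * N"
    by (simp add: square algebra_simps)
  finally have dvd: "M dvd s * B - c * N" .
  have no_multiple: "\<not> M dvd z" if "0 < \<bar>z\<bar>" "\<bar>z\<bar> < M" for z
    using that zdvd_not_zless[of "\<bar>z\<bar>" M] by simp
  from c show False
  proof
    assume "c = 8"
    have "s * B + x = (s * B - c * N) + M * 5"
      by (simp add: \<open>c = 8\<close> M_def N_def)
    with dvd have "M dvd s * B + x"
      by (metis dvd_add dvd_triv_left)
    then show False
      using no_multiple[of "s * B + x"] s B \<open>0 < y\<close> by (auto simp: M_def)
  next
    assume "c = 12"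
    have "s * B - (4 * y + x) = (s * B - c * N) + M * 7"
      by (simp add: \<open>c = 12\<close> M_def N_def)
    with dvd have "M dvd s * B - (4 * y + x)"
      by (metis dvd_add dvd_triv_left)
    then show False
      using no_multiple[of "s * B - (4 * y + x)"] s B \<open>0 < y\<close> by (auto simp: M_def)
  qed
qed

text \<open>
  The multiplier \<open>5\<close> and the sign in \<open>five_fib_square\<close> produce the constant \<open>c = 10 + 2 (-1)\<^sup>n\<close>, which is
  where the values \<open>8\<close> and \<open>12\<close> of the previous lemma come from.
\<close>

lemma sum_mult_fib_eq_square_imp_less:
  assumes "0 < n" and eq: "(\<Sum>j = 1..k. j * fib j) = (fib n)\<^sup>2"
  shows "k < 17"
proof (rule ccontr)
  assume "\<not> k < 17"
  define j where "j = k - 4"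
  have k: "k = j + 4" and j: "13 \<le> j"
    using \<open>\<not> k < 17\<close> by (simp_all add: j_def)
  obtain t where t: "2 * n = Suc (k + 1) + t"
    using index_lower_bound[OF _ assms] j k le_Suc_ex[of "k + 2" "2 * n"] by auto
  define x y where "x = int (fib j)" and "y = int (fib (Suc j))"
  define M N where "M = int (fib (k + 2))" and "N = int (fib (k + 1))"
  define e :: int where "e = (-1) ^ n"
  have e: "e = 1 \<or> e = -1"
    unfolding e_def by (cases "even n") auto
  have M: "M = 8 * y + 5 * x" and N: "N = 5 * y + 3 * x"
    by (simp_all add: M_def N_def x_def y_def k numeral_eq_Suc)
  have xy: "10 * int j + 35 < x" "x \<le> y"
    using linear_less_fib[OF j] fib_Suc_mono[of j] by (simp_all add: x_def y_def)
  have "int (\<Sum>j = 1..k. j * fib j) + (M + N) = int k * M + 2"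
    using arg_cong[OF sum_mult_fib[of k], of int] by (simp add: M_def N_def numeral_eq_Suc)
  moreover have "5 * (int (fib n))\<^sup>2 = M * int (lucas (Suc t)) + N * int (lucas t) - 2 * e"
    unfolding five_fib_square e_def t lucas_add by (simp add: M_def N_def)
  ultimately have main:
    "M * int (lucas (Suc t)) + N * int (lucas t) - 2 * e = 5 * (int k * M + 2 - M - N)"
    unfolding eq by simp
  (* N * lucas t is part of 5 F_n^2, which is below 5 (k - 1) M up to a constant; M <= 2 N lets N cancel. *)
  have bound: "int (lucas t) \<le> 10 * int (k - 1)"
  proof (rule ccontr)
    assume "\<not> ?thesis"
    then have "N * (10 * int (k - 1) + 1) \<le> N * int (lucas t)"
      using xy by (intro mult_left_mono) (auto simp: N)
    also have "\<dots> \<le> M * int (lucas (Suc t)) + N * int (lucas t)"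
      using xy by (simp add: M)
    also have "\<dots> = 5 * (M * int (k - 1)) - 5 * N + 10 + 2 * e"
      using main by (simp add: k algebra_simps)
    also have "5 * (M * int (k - 1)) \<le> 5 * (2 * N * int (k - 1))"
      using xy by (intro mult_left_mono mult_right_mono) (auto simp: M N)
    finally have "6 * N \<le> 10 + 2 * e"
      by (simp add: algebra_simps)
    then show False
      using e xy by (auto simp: N)
  qed
  have "N * (int (lucas t) + 5) - (10 + 2 * e) = M * (5 * (int k - 1) - int (lucas (Suc t)))"
    using main by (simp add: algebra_simps)
  then have "M dvd N * (int (lucas t) + 5) - (10 + 2 * e)"
    by simp
  moreover have "y\<^sup>2 - x * y - x\<^sup>2 = (-1) ^ j"
    using fib_Cassini_int[of j] by (simp add: x_def y_def algebra_simps power2_eq_square)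
  then have "\<not> M dvd N * (int (lucas t) + 5) - (10 + 2 * e)"
    unfolding M N
  proof (rule inverse_residue_not_small)
    show "(-1) ^ j = (1 :: int) \<or> (-1) ^ j = (-1 :: int)"
      by (cases "even j") auto
    show "int (lucas t) + 5 < x"
      using bound xy by (simp add: k)
  qed (use e xy in auto)
  ultimately show False
    by contradiction
qed

section \<open>The remaining indices\<close>

lemma small_sum_mult_fib_eq_square:
  assumes "0 < k" "k < 17" "0 < n" and eq: "(\<Sum>j = 1..k. j * fib j) = (fib n)\<^sup>2"
  shows "(k, n) \<in> {(1, 1), (1, 2), (3, 4)}"
proof -
  have small: "k \<in> {1, 2, 3, 4, 5, 6, 7, 8, 9, 10, 11, 12, 13, 14, 15, 16}"
    using assms(1,2) by (simp, presburger)
  have reduced: "k * fib (k + 2) + 2 = (fib n)\<^sup>2 + fib (k + 3)"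
    using sum_mult_fib[of k] eq by simp
  have "n < 14"
  proof (rule ccontr)
    assume "\<not> n < 14"
    then have "(fib 14)\<^sup>2 \<le> (fib n)\<^sup>2"
      by (intro power_mono fib_mono) auto
    then have "(fib 14)\<^sup>2 \<le> k * fib (k + 2) + 2"
      using reduced by linarith
    also have "\<dots> \<le> 16 * fib 18 + 2"
      using \<open>k < 17\<close> by (intro add_mono mult_mono fib_mono) auto
    finally show False
      by (simp add: fib_eval del: One_nat_def)
  qed
  then have "n \<in> {1, 2, 3, 4, 5, 6, 7, 8, 9, 10, 11, 12, 13}"
    using \<open>0 < n\<close> by (simp, presburger)
  then show ?thesis
    using small reduced by (elim insertE emptyE) (simp_all add: fib_eval del: One_nat_def)
qed

theorem theorem3:
  shows "(\<forall>k n :: nat. 0 < k \<longrightarrow> 0 < n \<longrightarrow> (\<Sum>j = 1..k. j * fib j) = (fib n)\<^sup>2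
            \<longrightarrow> (k, n) \<in> {(1, 1), (1, 2), (3, 4)})
       \<and> (\<forall>(k, n) \<in> {(1, 1), (1, 2), (3, 4)}.
            fib_solution 1 2 k n \<and> (nontrivial_fib_solution 1 2 k n \<longleftrightarrow> (k, n) = (3, 4)))"
proof (rule conjI)
  show "\<forall>k n :: nat. 0 < k \<longrightarrow> 0 < n \<longrightarrow> (\<Sum>j = 1..k. j * fib j) = (fib n)\<^sup>2
            \<longrightarrow> (k, n) \<in> {(1, 1), (1, 2), (3, 4)}"
    using sum_mult_fib_eq_square_imp_less small_sum_mult_fib_eq_square by blast
  show "\<forall>(k, n) \<in> {(1, 1), (1, 2), (3, 4)}.
            fib_solution 1 2 k n \<and> (nontrivial_fib_solution 1 2 k n \<longleftrightarrow> (k, n) = (3, 4))"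
    by (auto simp: fib_solution_def nontrivial_fib_solution_def trivial_fib_solution_def
        fib_eval numeral_eq_Suc)
qed

end
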